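(* Let $q(X)=q_1x_1^2+b_{12}x_1x_2+b_{13}x_1x_3+q_2x_2^2+b_{23}x_2x_3+q_3x_3^2$ be an integral nonsingular ternary quadratic form with matrix $Q$, let $N$ be the $4\times4$ matrix $$N=\begin{pmatrix}2 & -{}^tB\\ -B & {}^t\tilde Q_0+\tilde Q_0\end{pmatrix},$$ and let $p$ be a prime not dividing $\det q$. Then for every $M\in GL_4(\mathbb Z)\,\mathrm{diag}(1,1,p,p)\,GL_4(\mathbb Z)$ such that $N[M]\equiv 0 \pmod p$ (entrywise) there exists $A\in GL_3(\mathbb Z)\,\mathrm{diag}(1,p,p^2)\,GL_3(\mathbb Z)$, unique up to right multiplication by $GL_3(\mathbb Z)$, such that $Q[A]\equiv 0\pmod{p^2}$ (entrywise) and $M$ divides $\Psi_A$ from the left, i.e. $\Psi_A=MX$ for some integral $4\times 4$ matrix $X$.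
   Context: Conventions: for matrices $L, M$ write $L[M]={}^tMLM$; $\tilde Y$ denotes the adjugate of a square matrix $Y$. The matrix of $q$ is $Q=\begin{pmatrix}2q_1&b_{12}&b_{13}\\ b_{12}&2q_2&b_{23}\\ b_{13}&b_{23}&2q_3\end{pmatrix}$, so $2q(X)={}^tXQX$, and $\det q=\det Q$. Put $Q_0=\begin{pmatrix}q_1&b_{12}&b_{13}\\0&q_2&b_{23}\\0&0&q_3\end{pmatrix}$ and $B={}^t(-b_{23},b_{13},-b_{12})$. ($N$ is the matrix of the norm form $x\bar x$ on the even Clifford subalgebra $C_0(\mathbb Z^3,q)$ with respect to the basis $e_0,e_2e_3,-e_1e_3,e_1e_2$.) For an integral $3\times 3$ matrix $A$ with $Q[A]\equiv 0 \pmod {p^2}$ and $\det A=\pm p^3$, with columns $A_1,A_2,A_3$, define the $4\times 4$ matrix $$\Psi_A=\begin{pmatrix} p & p^{-1}\big({}^tA_3Q_0A_2,\ -{}^tA_3Q_0A_1,\ {}^tA_2Q_0A_1\big)\\ 0 & \\ 0 & p^2\,{}^tA^{-1}\\ 0 & \end{pmatrix}$$ (first column ${}^t(p,0,0,0)$, lower-right $3\times3$ block $p^2\,{}^t(A^{-1})$). *)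

theory Defs
  imports "HOL-Analysis.Analysis" "HOL-Number_Theory.Cong"
begin

definition diag_mat :: "'a::zero ^ 'n \<Rightarrow> 'a ^ 'n ^ 'n" where
  "diag_mat d = (\<chi> i j. if i = j then d $ i else 0)"

definition GL_double_coset :: "int ^ 'n ^ 'n \<Rightarrow> (int ^ 'n ^ 'n) set" where
  "GL_double_coset D = {U ** D ** V | U V. invertible U \<and> invertible V}"

definition mat_cong :: "int ^ 'n ^ 'm \<Rightarrow> int ^ 'n ^ 'm \<Rightarrow> int \<Rightarrow> bool" where
  "mat_cong L M m \<longleftrightarrow> (\<forall>i j. [L $ i $ j = M $ i $ j] (mod m))"

text \<open>The substitution written \<open>L[M]\<close> in the theory of quadratic forms.\<close>

definition mat_subst :: "'a::comm_ring_1 ^ 'n ^ 'n \<Rightarrow> 'a ^ 'm ^ 'n \<Rightarrow> 'a ^ 'm ^ 'm" where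
  "mat_subst L M = transpose M ** L ** M"

text \<open>The \<open>(i,j)\<close> entry is the cofactor at position \<open>(j,i)\<close>, obtained as the determinant
  after replacing row \<open>j\<close> by the \<open>i\<close>-th unit vector.\<close>

definition adjugate :: "'a::comm_ring_1 ^ 'n ^ 'n \<Rightarrow> 'a ^ 'n ^ 'n" where
  "adjugate Y = (\<chi> i j. det (\<chi> k. if k = j then axis i 1 else Y $ k))"

lemma mult_adjugate_3:
  fixes Y :: "'a::comm_ring_1 ^ 3 ^ 3"
  shows "Y ** adjugate Y = mat (det Y)"
  by (simp add: vec_eq_iff matrix_matrix_mult_def adjugate_def mat_def axis_def det_3 sum_3 forall_3)
    (simp add: algebra_simps)

definition bilin :: "'a::comm_ring_1 ^ 'n ^ 'm \<Rightarrow> 'a ^ 'm \<Rightarrow> 'a ^ 'n \<Rightarrow> 'a" where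
  "bilin P x y = (\<Sum>i\<in>UNIV. \<Sum>j\<in>UNIV. x $ i * P $ i $ j * y $ j)"

text \<open>The block matrix with corner \<open>a\<close>, remaining first row \<open>r\<close>, remaining first column \<open>c\<close>
  and lower right block \<open>D\<close>.\<close>

definition block_1_3 :: "'a::zero \<Rightarrow> 'a ^ 3 \<Rightarrow> 'a ^ 3 \<Rightarrow> 'a ^ 3 ^ 3 \<Rightarrow> 'a ^ 4 ^ 4" where
  "block_1_3 a r c D = vector
    [vector [a, r $ 1, r $ 2, r $ 3],
     vector [c $ 1, D $ 1 $ 1, D $ 1 $ 2, D $ 1 $ 3],
     vector [c $ 2, D $ 2 $ 1, D $ 2 $ 2, D $ 2 $ 3],
     vector [c $ 3, D $ 3 $ 1, D $ 3 $ 2, D $ 3 $ 3]]"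

lemma block_1_3_nth:
  "block_1_3 a r c D $ 1 = vector [a, r $ 1, r $ 2, r $ 3]"
  "block_1_3 a r c D $ 2 = vector [c $ 1, D $ 1 $ 1, D $ 1 $ 2, D $ 1 $ 3]"
  "block_1_3 a r c D $ 3 = vector [c $ 2, D $ 2 $ 1, D $ 2 $ 2, D $ 2 $ 3]"
  "block_1_3 a r c D $ 4 = vector [c $ 3, D $ 3 $ 1, D $ 3 $ 2, D $ 3 $ 3]"
  by (simp_all add: block_1_3_def vector_def)

text \<open>An integral ternary quadratic form, given by its coefficients.\<close>

datatype ternary_form =
  Ternary_Form (q1: int) (b12: int) (b13: int) (q2: int) (b23: int) (q3: int)

definition form_eval :: "ternary_form \<Rightarrow> int ^ 3 \<Rightarrow> int" where
  "form_eval q x =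
     q1 q * (x $ 1)\<^sup>2 + b12 q * x $ 1 * x $ 2 + b13 q * x $ 1 * x $ 3
   + q2 q * (x $ 2)\<^sup>2 + b23 q * x $ 2 * x $ 3 + q3 q * (x $ 3)\<^sup>2"

definition Q_mat :: "ternary_form \<Rightarrow> int ^ 3 ^ 3" where
  "Q_mat q = vector
    [vector [2 * q1 q, b12 q, b13 q],
     vector [b12 q, 2 * q2 q, b23 q],
     vector [b13 q, b23 q, 2 * q3 q]]"

lemma bilin_Q_mat: "bilin (Q_mat q) x x = 2 * form_eval q x"
  by (simp add: bilin_def Q_mat_def form_eval_def sum_3 algebra_simps power2_eq_square)

definition Q0_mat :: "ternary_form \<Rightarrow> int ^ 3 ^ 3" where
  "Q0_mat q = vector
    [vector [q1 q, b12 q, b13 q],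
     vector [0, q2 q, b23 q],
     vector [0, 0, q3 q]]"

definition B_vec :: "ternary_form \<Rightarrow> int ^ 3" where
  "B_vec q = vector [- b23 q, b13 q, - b12 q]"

text \<open>The matrix of the norm form on the even Clifford algebra.\<close>

definition N_mat :: "ternary_form \<Rightarrow> int ^ 4 ^ 4" where
  "N_mat q = block_1_3 2 (- B_vec q) (- B_vec q)
     (transpose (adjugate (Q0_mat q)) + adjugate (Q0_mat q))"

text \<open>The matrix \<open>\<Psi>\<^sub>A\<close>. It is rational by definition, and it is only meaningful
  if \<open>Q[A]\<close> is divisible by \<open>p\<^sup>2\<close> and \<open>det A = \<plusminus>p\<^sup>3\<close>.\<close>

definition Psi :: "ternary_form \<Rightarrow> int \<Rightarrow> int ^ 3 ^ 3 \<Rightarrow> rat ^ 4 ^ 4" where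
  "Psi q p A = block_1_3 (of_int p)
     (vector
       [of_int (bilin (Q0_mat q) (column 3 A) (column 2 A)) / of_int p,
        - of_int (bilin (Q0_mat q) (column 3 A) (column 1 A)) / of_int p,
        of_int (bilin (Q0_mat q) (column 2 A) (column 1 A)) / of_int p])
     0
     (map_matrix ((*) (of_int (p\<^sup>2))) (transpose (matrix_inv (map_matrix of_int A))))"

definition left_divides :: "int ^ 'n ^ 'n \<Rightarrow> rat ^ 'n ^ 'n \<Rightarrow> bool" where
  "left_divides M S \<longleftrightarrow>
     (\<exists>X :: int ^ 'n ^ 'n. S = map_matrix of_int M ** map_matrix of_int X)"

end

theory Submission
  imports Defs
begin

text \<open>
  Since \<open>det Q\<close> is even, \<open>p\<close> is odd. Modulo \<open>p\<close> the columns of \<open>M\<close> span a plane on which the norm form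
  vanishes, and this plane contains exactly one line of elements of trace zero. On trace zero
  elements \<open>x = (x\<^sub>0, y)\<close>, \<open>2 N[x] = (adj Q)[y]\<close>, so this line
  corresponds through \<open>y \<mapsto> (adj Q) y\<close> to an isotropic line of \<open>q\<close> modulo \<open>p\<close>.
  On the other side, \<open>A = W diag(1, p, p\<^sup>2) V\<close> with \<open>Q[A] \<equiv> 0\<close> modulo \<open>p\<^sup>2\<close> is determined up to
  \<open>GL\<^sub>3(\<int>)\<close> by the isotropic line of the first column \<open>W\<^sub>1\<close>: its column lattice is
  \<open>\<int> v + p {x. x \<bottom> v mod p}\<close>, where \<open>v\<close> lifts \<open>W\<^sub>1\<close> to an isotropic vector modulo \<open>p\<^sup>2\<close>. Finally
  \<open>\<Psi>\<^sub>A\<close> has rank one modulo \<open>p\<close>, and the lower part of its image is spanned by the third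
  row of \<open>W\<inverse>\<close>, which is proportional to \<open>Q W\<^sub>1\<close>. So \<open>M\<close> divides \<open>\<Psi>\<^sub>A\<close> only if the two isotropic
  lines agree, and for \<open>det A = p\<^sup>3\<close> also conversely.
\<close>

section \<open>Matrices and bilinear forms\<close>

lemma vector_4_nth:
  "(vector [a, b, c, d] :: 'a::zero ^ 4) $ 1 = a"
  "(vector [a, b, c, d] :: 'a::zero ^ 4) $ 2 = b"
  "(vector [a, b, c, d] :: 'a::zero ^ 4) $ 3 = c"
  "(vector [a, b, c, d] :: 'a::zero ^ 4) $ 4 = d"
  by (simp_all add: vector_def)

lemma adjugate_mult_3:
  fixes Y :: "'a::comm_ring_1 ^ 3 ^ 3"
  shows "adjugate Y ** Y = mat (det Y)"
  by (simp add: vec_eq_iff matrix_matrix_mult_def adjugate_def mat_def axis_def det_3 sum_3 forall_3)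
    (simp add: algebra_simps)

lemma invertible_if_det_dvd_1:
  fixes W :: "'a::comm_ring_1 ^ 3 ^ 3"
  assumes "det W dvd 1"
  shows "invertible W"
proof -
  obtain d where d: "det W * d = 1" using assms by (auto simp: dvd_def)
  then have m: "mat (det W) ** mat d = (mat 1 :: 'a ^ 3 ^ 3)" "mat d ** mat (det W) = (mat 1 :: 'a ^ 3 ^ 3)"
    by (simp_all add: vec_eq_iff matrix_matrix_mult_def mat_def sum_3 forall_3 mult.commute)
  let ?L = "mat d ** adjugate W" and ?R = "adjugate W ** mat d"
  have L: "?L ** W = mat 1" using m by (simp add: adjugate_mult_3 flip: matrix_mul_assoc)
  have R: "W ** ?R = mat 1" using m by (simp add: mult_adjugate_3 matrix_mul_assoc)
  have "?L = ?L ** (W ** ?R)" by (simp only: R matrix_mul_rid)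
  also have "\<dots> = ?R" by (simp only: L matrix_mul_assoc matrix_mul_lid)
  finally have "?L = ?R" .
  then show ?thesis using L R unfolding invertible_def by metis
qed

lemma matrix_mult_diag_mat_nth:
  fixes X :: "'a::comm_ring_1 ^ 'n ^ 'm"
  shows "(X ** diag_mat d) $ i $ j = X $ i $ j * d $ j"
  by (simp add: matrix_matrix_mult_def diag_mat_def if_distrib[of "(*) _"] cong: if_cong)

lemma diag_mat_mult_matrix_nth:
  fixes X :: "'a::comm_ring_1 ^ 'n ^ 'm"
  shows "(diag_mat d ** X) $ i $ j = d $ i * X $ i $ j"
  by (simp add: matrix_matrix_mult_def diag_mat_def if_distrib[of "\<lambda>x. x * _"] cong: if_cong)

lemma matrix_mult_mat_commute:
  fixes X :: "'a::comm_ring_1 ^ 'n ^ 'n"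
  shows "X ** mat m = mat m ** X"
proof -
  have eq: "mat m = (diag_mat (\<chi> i. m) :: 'a ^ 'n ^ 'n)"
    by (simp add: mat_def diag_mat_def vec_eq_iff)
  show ?thesis
    unfolding eq by (simp add: vec_eq_iff matrix_mult_diag_mat_nth diag_mat_mult_matrix_nth mult.commute)
qed

lemma mat_mult_vector_nth:
  fixes x :: "'a::comm_ring_1 ^ 'n"
  shows "(mat m *v x) $ i = m * x $ i"
  by (simp add: matrix_vector_mult_def mat_def if_distrib[of "\<lambda>x. x * _"] cong: if_cong)

lemma matrix_vector_mult_scale:
  fixes A :: "'a::comm_ring_1 ^ 'n ^ 'm"
  shows "A *v (c *s x) = c *s (A *v x)"
  by (simp add: vec_eq_iff matrix_vector_mult_def sum_distrib_left algebra_simps)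

text \<open>Yields an integral \<open>T\<close> with \<open>A ** T = mat m\<close>, a substitute for
  \<open>m\<close> times the inverse.\<close>

lemma scaled_inverse_mult:
  fixes U D V :: "'a::comm_ring_1 ^ 'n ^ 'n"
  assumes "U ** U' = mat 1" "V ** V' = mat 1" "D ** E = mat m"
  shows "(U ** D ** V) ** (V' ** E ** U') = mat m"
proof -
  have "(U ** D ** V) ** (V' ** E ** U') = U ** (D ** ((V ** V') ** E)) ** U'"
    by (simp only: matrix_mul_assoc)
  also have "\<dots> = mat m ** (U ** U')"
    by (simp only: assms(2,3) matrix_mul_lid matrix_mult_mat_commute matrix_mul_assoc)
  finally show ?thesis by (simp add: assms(1))
qed

lemma diag_mat_3_scaled_inverse:
  fixes p :: int
  shows "diag_mat (vector [1, p, p\<^sup>2] :: int ^ 3) ** diag_mat (vector [p\<^sup>2, p, 1]) = mat (p\<^sup>2)"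
  by (simp add: vec_eq_iff diag_mat_mult_matrix_nth)
    (simp add: diag_mat_def mat_def forall_3 power2_eq_square)

lemma diag_mat_4_scaled_inverse:
  fixes p :: int
  shows "diag_mat (vector [1, 1, p, p] :: int ^ 4) ** diag_mat (vector [p, p, 1, 1]) = mat p"
  by (simp add: vec_eq_iff diag_mat_mult_matrix_nth)
    (simp add: diag_mat_def mat_def forall_4 vector_4_nth)

lemma column_eq_mult:
  fixes A :: "'a::comm_ring_1 ^ 'n ^ 'm"
  shows "column j A = A *v axis j 1"
  by (simp add: vec_eq_iff column_def matrix_vector_mult_def axis_def if_distrib[of "(*) _"] cong: if_cong)

lemma map_matrix_of_int_mult:
  "map_matrix of_int (A ** B) = (map_matrix of_int A ** map_matrix of_int B :: 'a::comm_ring_1 ^ 'n ^ 'm)"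
  by (simp add: vec_eq_iff matrix_matrix_mult_def)

text \<open>Makes the rational block of \<open>Psi\<close> integral: \<open>T / m\<close> is a right
  inverse of \<open>A\<close> over the rationals, hence two-sided.\<close>

lemma scaled_inverse_transpose:
  fixes A T :: "int ^ 'n ^ 'n" and m :: int
  assumes AT: "A ** T = mat m" and m: "m \<noteq> 0"
  shows "map_matrix ((*) (of_int m)) (transpose (matrix_inv (map_matrix of_int A))) =
    map_matrix (of_int :: int \<Rightarrow> rat) (transpose T)"
proof -
  let ?A = "map_matrix of_int A :: rat ^ 'n ^ 'n"
  define R :: "rat ^ 'n ^ 'n" where "R = map_matrix (\<lambda>x. of_int x / of_int m) T"
  have "(?A ** R) $ i $ j = mat 1 $ i $ j" for i j
  proof -
    have "(?A ** R) $ i $ j = of_int ((A ** T) $ i $ j) / of_int m"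
      by (simp add: R_def matrix_matrix_mult_def sum_divide_distrib)
    then show ?thesis using m by (simp add: AT mat_def)
  qed
  then have R: "?A ** R = mat 1" by (simp add: vec_eq_iff)
  then have "R ** ?A = mat 1" by (simp add: matrix_left_right_inverse)
  with R have i: "invertible ?A" unfolding invertible_def by blast
  have "matrix_inv ?A = matrix_inv ?A ** (?A ** R)" by (simp only: R matrix_mul_rid)
  also have "\<dots> = R"
    using someI_ex[OF i[unfolded invertible_def]] by (simp add: matrix_inv_def matrix_mul_assoc)
  finally show ?thesis using m by (simp add: vec_eq_iff R_def transpose_def)
qed

lemma left_divides_of_int:
  assumes "\<And>j. \<exists>z. column j S = M *v z"
  shows "left_divides M (map_matrix of_int S)"
proof -
  obtain z where z: "\<And>j. column j S = M *v z j" using assms by metis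
  have "S = M ** (\<chi> i j. z j $ i)"
    using z by (simp add: vec_eq_iff column_def matrix_vector_mult_def matrix_matrix_mult_def)
  then show ?thesis unfolding left_divides_def by (metis map_matrix_of_int_mult)
qed

lemma left_divides_obtains:
  assumes "left_divides M P"
  obtains X where "P = map_matrix of_int (M ** X)"
  using assms unfolding left_divides_def by (metis map_matrix_of_int_mult)

section \<open>Bilinear forms under substitution\<close>

lemma bilin_conv_mult: "bilin P x y = (\<Sum>i\<in>UNIV. x $ i * (P *v y) $ i)"
  by (simp add: bilin_def matrix_vector_mult_def sum_distrib_left mult.assoc)

lemma bilin_mult_right: "bilin P x (B *v y) = bilin (P ** B) x y"
  by (simp add: bilin_conv_mult matrix_vector_mul_assoc)

lemma bilin_mult_left: "bilin P (A *v x) y = bilin (transpose A ** P) x y"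
proof -
  have "(\<Sum>i\<in>UNIV. (A *v x) $ i * z $ i) = (\<Sum>i\<in>UNIV. x $ i * (transpose A *v z) $ i)" for z
    unfolding matrix_vector_mult_def transpose_def
    by (simp add: sum_distrib_left sum_distrib_right, subst sum.swap) (simp add: ac_simps)
  then show ?thesis
    unfolding bilin_conv_mult matrix_vector_mul_assoc[symmetric] .
qed

lemma bilin_axis:
  fixes P :: "'a::comm_ring_1 ^ 'n ^ 'm"
  shows "bilin P (axis i 1) (axis j 1) = P $ i $ j"
  by (simp add: bilin_def axis_def if_distrib[of "(*) _"] if_distrib[of "\<lambda>x. x * _"] cong: if_cong)

lemma bilin_scale:
  "bilin P (a *s x) (b *s y) = a * b * bilin P x y"
  by (simp add: bilin_def sum_distrib_left algebra_simps)

lemma bilin_cong: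
  fixes m :: int
  assumes "\<And>i. [x $ i = x' $ i] (mod m)" "\<And>i. [y $ i = y' $ i] (mod m)"
  shows "[bilin P x y = bilin P x' y'] (mod m)"
  unfolding bilin_def by (intro cong_sum cong_mult cong_refl assms)

lemma mat_subst_nth: "mat_subst P W $ i $ j = bilin P (column i W) (column j W)"
  by (simp add: column_eq_mult bilin_mult_left bilin_mult_right bilin_axis mat_subst_def
      matrix_mul_assoc)

lemma mat_subst_mult: "mat_subst P (A ** B) = mat_subst (mat_subst P A) B"
  by (simp add: mat_subst_def matrix_transpose_mul matrix_mul_assoc)

lemma transpose_mat_subst: "transpose (mat_subst P W) = mat_subst (transpose P) W"
  by (simp add: mat_subst_def matrix_transpose_mul matrix_mul_assoc)

lemma mat_subst_diag_mat_nth: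
  "mat_subst P (W ** diag_mat d) $ i $ j = d $ i * mat_subst P W $ i $ j * d $ j"
proof -
  have "transpose (diag_mat d) = diag_mat d" by (simp add: vec_eq_iff transpose_def diag_mat_def)
  then have "mat_subst P (W ** diag_mat d) = diag_mat d ** mat_subst P W ** diag_mat d"
    by (simp add: mat_subst_def matrix_transpose_mul matrix_mul_assoc)
  then show ?thesis by (simp only: matrix_mult_diag_mat_nth diag_mat_mult_matrix_nth)
qed

lemma mat_cong_0_iff: "mat_cong L 0 m \<longleftrightarrow> (\<forall>i j. m dvd L $ i $ j)"
  by (simp add: mat_cong_def cong_0_iff)

lemma mat_cong_0_subst:
  assumes "mat_cong L 0 m"
  shows "mat_cong (mat_subst L V) 0 m"
  using assms unfolding mat_cong_0_iff mat_subst_nth bilin_def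
  by (intro allI dvd_sum dvd_mult2 dvd_mult) auto

section \<open>Linear congruences and unimodular completion\<close>

lemma ex_root_mod_prime:
  fixes p :: int
  assumes "prime p" "\<not> p dvd b"
  shows "\<exists>k. p dvd a + b * k"
proof -
  have "coprime b p" using assms by (metis prime_imp_coprime coprime_commute)
  then obtain k where "[b * k = 1] (mod p)" using cong_solve_coprime_int by blast
  then have "[a + b * k * (- a) = a + 1 * (- a)] (mod p)"
    by (intro cong_add cong_mult cong_refl)
  then show ?thesis by (auto simp: cong_0_iff mult.assoc intro!: exI[of _ "k * (- a)"])
qed

text \<open>The vector need not be primitive, but scaling by an inverse of \<open>v $ i\<close>
  modulo p^2 makes entry \<open>i\<close> congruent to 1, and a column with an entry 1 completes to
  determinant 1.\<close>

lemma exists_unimodular_column: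
  fixes v :: "int ^ 3" and p :: int
  assumes p: "prime p" and v: "\<not> p dvd v $ i"
  obtains W c where "det W = 1" "\<And>j. p\<^sup>2 dvd W $ j $ 1 - c * v $ j"
proof -
  have "coprime (v $ i) (p\<^sup>2)"
    using p v by (simp add: prime_imp_coprime coprime_commute)
  then obtain c where "[v $ i * c = 1] (mod p\<^sup>2)" using cong_solve_coprime_int by blast
  then have c: "p\<^sup>2 dvd 1 - c * v $ i"
    by (metis cong_iff_dvd_diff cong_sym mult.commute)
  define W :: "int ^ 3 ^ 3" where "W =
    (if i = 1 then vector [vector [1, 0, 0], vector [c * v $ 2, 1, 0], vector [c * v $ 3, 0, 1]]
     else if i = 2 then vector [vector [c * v $ 1, -1, 0], vector [1, 0, 0], vector [c * v $ 3, 0, 1]]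
     else vector [vector [c * v $ 1, 1, 0], vector [c * v $ 2, 0, 1], vector [1, 0, 0]])"
  have i: "i = 1 \<or> i = 2 \<or> i = 3" by (rule exhaust_3)
  have "det W = 1" using i by (auto simp: W_def det_3)
  moreover have "\<forall>j. p\<^sup>2 dvd W $ j $ 1 - c * v $ j"
    using i c by (auto simp: W_def forall_3)
  ultimately show thesis using that by blast
qed

section \<open>The ternary form and the norm form\<close>

lemma Q_mat_nth [simp]:
  "Q_mat q $ 1 $ 1 = 2 * q1 q" "Q_mat q $ 1 $ 2 = b12 q" "Q_mat q $ 1 $ 3 = b13 q"
  "Q_mat q $ 2 $ 1 = b12 q" "Q_mat q $ 2 $ 2 = 2 * q2 q" "Q_mat q $ 2 $ 3 = b23 q"
  "Q_mat q $ 3 $ 1 = b13 q" "Q_mat q $ 3 $ 2 = b23 q" "Q_mat q $ 3 $ 3 = 2 * q3 q"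
  by (simp_all add: Q_mat_def)

lemma transpose_Q_mat [simp]: "transpose (Q_mat q) = Q_mat q"
  by (simp add: vec_eq_iff transpose_def forall_3)

lemma even_det_Q_mat: "2 dvd det (Q_mat q)"
  by (simp add: det_3)

lemma adjugate_Q_mat_nth [simp]:
  "adjugate (Q_mat q) $ 1 $ 1 = 4 * q2 q * q3 q - (b23 q)\<^sup>2"
  "adjugate (Q_mat q) $ 1 $ 2 = b13 q * b23 q - 2 * q3 q * b12 q"
  "adjugate (Q_mat q) $ 1 $ 3 = b12 q * b23 q - 2 * q2 q * b13 q"
  "adjugate (Q_mat q) $ 2 $ 1 = b13 q * b23 q - 2 * q3 q * b12 q"
  "adjugate (Q_mat q) $ 2 $ 2 = 4 * q1 q * q3 q - (b13 q)\<^sup>2"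
  "adjugate (Q_mat q) $ 2 $ 3 = b12 q * b13 q - 2 * q1 q * b23 q"
  "adjugate (Q_mat q) $ 3 $ 1 = b12 q * b23 q - 2 * q2 q * b13 q"
  "adjugate (Q_mat q) $ 3 $ 2 = b12 q * b13 q - 2 * q1 q * b23 q"
  "adjugate (Q_mat q) $ 3 $ 3 = 4 * q1 q * q2 q - (b12 q)\<^sup>2"
  by (simp_all add: adjugate_def det_3 axis_def power2_eq_square)

lemma mat_subst_Q_mat_commute: "mat_subst (Q_mat q) W $ i $ j = mat_subst (Q_mat q) W $ j $ i"
proof -
  have "transpose (mat_subst (Q_mat q) W) = mat_subst (Q_mat q) W"
    by (simp add: transpose_mat_subst)
  from arg_cong[OF this, of "\<lambda>X. X $ j $ i"] show ?thesis by (simp add: transpose_def)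
qed

text \<open>From \<open>Q adj(Q) Q = det(Q) Q\<close> and the symmetry of \<open>Q\<close>.\<close>

lemma bilin_adjugate_Q_mat:
  "bilin (adjugate (Q_mat q)) (Q_mat q *v x) (Q_mat q *v y) = det (Q_mat q) * bilin (Q_mat q) x y"
proof -
  have "bilin (mat d ** P) x y = d * bilin P x y" for d and P :: "int ^ 3 ^ 3"
    by (simp add: bilin_def matrix_matrix_mult_def mat_def sum_3 algebra_simps)
  then show ?thesis
    by (simp add: bilin_mult_left bilin_mult_right matrix_mul_assoc mult_adjugate_3)
qed

text \<open>The trace of the Clifford element with coordinates \<open>x\<close>, which is \<open>N(1, x)\<close>.\<close>

definition clifford_trace :: "ternary_form \<Rightarrow> int ^ 4 \<Rightarrow> int" where
  "clifford_trace q x = 2 * x $ 1 - (B_vec q $ 1 * x $ 2 + B_vec q $ 2 * x $ 3 + B_vec q $ 3 * x $ 4)"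

definition im_part :: "'a ^ 4 \<Rightarrow> 'a ^ 3" where
  "im_part x = (\<chi> i. x $ (if i = 1 then 2 else if i = 2 then 3 else 4))"

lemma im_part_nth [simp]:
  "im_part x $ 1 = x $ 2" "im_part x $ 2 = x $ 3" "im_part x $ 3 = x $ 4"
  by (simp_all add: im_part_def)

lemma N_mat_nth [simp]:
  "N_mat q $ 1 $ 1 = 2" "N_mat q $ 1 $ 2 = b23 q"
  "N_mat q $ 1 $ 3 = - b13 q" "N_mat q $ 1 $ 4 = b12 q"
  "N_mat q $ 2 $ 1 = b23 q" "N_mat q $ 2 $ 2 = 2 * q2 q * q3 q"
  "N_mat q $ 2 $ 3 = - b12 q * q3 q" "N_mat q $ 2 $ 4 = b12 q * b23 q - b13 q * q2 q"
  "N_mat q $ 3 $ 1 = - b13 q" "N_mat q $ 3 $ 2 = - b12 q * q3 q"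
  "N_mat q $ 3 $ 3 = 2 * q1 q * q3 q" "N_mat q $ 3 $ 4 = - q1 q * b23 q"
  "N_mat q $ 4 $ 1 = b12 q" "N_mat q $ 4 $ 2 = b12 q * b23 q - b13 q * q2 q"
  "N_mat q $ 4 $ 3 = - q1 q * b23 q" "N_mat q $ 4 $ 4 = 2 * q1 q * q2 q"
  by (simp_all add: N_mat_def block_1_3_nth vector_4_nth transpose_def B_vec_def
      adjugate_def det_3 axis_def Q0_mat_def)

text \<open>This comes from \<open>adj Q = 2 (adj Q\<^sub>0 + \<^sup>t(adj Q\<^sub>0)) - B \<^sup>tB\<close>.\<close>

lemma N_mat_bilin:
  "2 * bilin (N_mat q) x x' =
     clifford_trace q x * clifford_trace q x' + bilin (adjugate (Q_mat q)) (im_part x) (im_part x')"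
  by (simp add: bilin_def sum_4 sum_3 clifford_trace_def B_vec_def algebra_simps power2_eq_square)

section \<open>Isotropic lines and neighbours\<close>

text \<open>\<open>F\<close> is the Gram matrix of a frame, \<open>H\<close> the change to a second
  one. Modulo p, \<open>F\<close> vanishes above its antidiagonal, whose entries are units. The
  conclusions say that \<open>D^-1 H D\<close> is integral for
  \<open>D = diag(1, p, p^2)\<close>.\<close>

lemma isotropic_base_change:
  fixes F H :: "int ^ 3 ^ 3" and p :: int
  assumes p: "prime p" and p2: "\<not> p dvd 2" and dF: "\<not> p dvd det F" and dH: "\<not> p dvd det H"
    and sym: "transpose F = F"
    and F11: "p\<^sup>2 dvd F $ 1 $ 1" and F12: "p dvd F $ 1 $ 2"
    and F': "p\<^sup>2 dvd mat_subst F H $ 1 $ 1" "p dvd mat_subst F H $ 1 $ 2"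
    and FH: "p dvd (F ** H) $ 1 $ 1"
  shows "p dvd H $ 2 $ 1" "p\<^sup>2 dvd H $ 3 $ 1" "p dvd H $ 3 $ 2"
proof -
  have s: "F $ 2 $ 1 = F $ 1 $ 2" "F $ 3 $ 1 = F $ 1 $ 3" "F $ 3 $ 2 = F $ 2 $ 3"
    using arg_cong[OF sym, of "\<lambda>X. X $ 1 $ 2"] arg_cong[OF sym, of "\<lambda>X. X $ 1 $ 3"]
      arg_cong[OF sym, of "\<lambda>X. X $ 2 $ 3"]
    by (simp_all add: transpose_def)
  obtain a where a: "F $ 1 $ 1 = p * p * a" using F11 by (auto simp: power2_eq_square)
  obtain b where b: "F $ 1 $ 2 = p * b" using F12 by auto
  have "det F = p * (a * p * (F$2$2 * F$3$3 - F$2$3 * F$2$3) - b * (p * b * F$3$3 - F$2$3 * F$1$3)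
          + F$1$3 * b * F$2$3) - F$1$3 * F$1$3 * F$2$2"
    by (simp add: det_3 s a b algebra_simps)
  with dF have u13: "\<not> p dvd F $ 1 $ 3" and u22: "\<not> p dvd F $ 2 $ 2"
    by auto
  have "(F ** H) $ 1 $ 1 = p * (p * a * H$1$1 + b * H$2$1) + F$1$3 * H$3$1"
    by (simp add: matrix_matrix_mult_def sum_3 a b algebra_simps)
  with FH have "p dvd F$1$3 * H$3$1"
    by (metis dvd_add_right_iff dvd_triv_left)
  then have "p dvd H$3$1" using u13 p by (simp add: prime_dvd_mult_iff)
  then obtain d where d: "H$3$1 = p * d" by auto
  have "mat_subst F H $ 1 $ 1 = p * (p * a * H$1$1 * H$1$1 + 2 * b * H$1$1 * H$2$1
      + 2 * F$1$3 * H$1$1 * d + 2 * F$2$3 * H$2$1 * d + F$3$3 * p * d * d) + F$2$2 * (H$2$1)\<^sup>2"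
    by (simp add: mat_subst_def matrix_matrix_mult_def transpose_def sum_3 a b d s algebra_simps
        power2_eq_square)
  moreover have "p dvd mat_subst F H $ 1 $ 1"
    using F'(1) by (metis dvd_mult_left power2_eq_square)
  ultimately have "p dvd F$2$2 * (H$2$1)\<^sup>2"
    by (metis dvd_add_right_iff dvd_triv_left)
  then show h2: "p dvd H$2$1"
    using u22 p by (metis prime_dvd_mult_iff prime_dvd_power)
  then obtain c where c: "H$2$1 = p * c" by auto
  have "det H = H$1$1 * (H$2$2 * H$3$3 - H$2$3 * H$3$2) + p * (d * (H$1$2 * H$2$3 - H$1$3 * H$2$2)
      + c * (H$1$3 * H$3$2 - H$1$2 * H$3$3))"
    by (simp add: det_3 c d algebra_simps)
  with dH have u1: "\<not> p dvd H$1$1" by auto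
  \<comment> \<open>Once \<open>H$2$1\<close> and \<open>H$3$1\<close> are divisible by p, only this
    cross term survives modulo p^2; its coefficient is a unit because p is odd.\<close>
  have "mat_subst F H $ 1 $ 1 = p\<^sup>2 * (a * H$1$1 * H$1$1 + 2 * b * H$1$1 * c
      + 2 * F$2$3 * c * d + F$3$3 * d * d + F$2$2 * c * c) + (2 * F$1$3 * H$1$1) * (p * d)"
    by (simp add: mat_subst_def matrix_matrix_mult_def transpose_def sum_3 a b c d s algebra_simps
        power2_eq_square)
  with F'(1) have "p\<^sup>2 dvd (2 * F$1$3 * H$1$1) * (p * d)"
    by (metis dvd_add_right_iff dvd_triv_left)
  moreover have "\<not> p dvd 2 * F$1$3 * H$1$1"
    using p p2 u1 u13 by (metis prime_dvd_mult_iff)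
  then have "coprime (p\<^sup>2) (2 * F$1$3 * H$1$1)"
    by (metis p prime_imp_coprime coprime_power_left_iff)
  ultimately show "p\<^sup>2 dvd H$3$1" using d by (simp add: coprime_dvd_mult_right_iff)
  have "mat_subst F H $ 1 $ 2 = p * (H$1$1 * (p * a * H$1$2 + b * H$2$2)
      + c * (p * b * H$1$2 + F$2$2 * H$2$2 + F$2$3 * H$3$2)
      + d * (F$1$3 * H$1$2 + F$2$3 * H$2$2 + F$3$3 * H$3$2)) + (F$1$3 * H$1$1) * H$3$2"
    by (simp add: mat_subst_def matrix_matrix_mult_def transpose_def sum_3 a b c d s algebra_simps)
  with F'(2) have "p dvd (F$1$3 * H$1$1) * H$3$2"
    by (metis dvd_add_right_iff dvd_triv_left)
  then show "p dvd H$3$2" using p u1 u13 by (simp add: prime_dvd_mult_iff)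
qed

text \<open>With \<open>D = diag(1, p, p\<^sup>2)\<close>, these are the conditions on \<open>W \<in> GL\<^sub>3(\<int>)\<close> under which \<open>A = W D\<close> satisfies
  \<open>Q[A] \<equiv> 0\<close> modulo \<open>p\<^sup>2\<close>. Up to right multiplication by \<open>GL\<^sub>3(\<int>)\<close>, \<open>A\<close> depends only on the line
  spanned modulo \<open>p\<close> by the first column of \<open>W\<close>.\<close>

definition isotropic_frame :: "ternary_form \<Rightarrow> int \<Rightarrow> int ^ 3 ^ 3 \<Rightarrow> int ^ 3 ^ 3 \<Rightarrow> bool" where
  "isotropic_frame q p W W' \<longleftrightarrow> W ** W' = mat 1 \<and> W' ** W = mat 1
     \<and> p\<^sup>2 dvd mat_subst (Q_mat q) W $ 1 $ 1 \<and> p dvd mat_subst (Q_mat q) W $ 1 $ 2"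

section \<open>Frames and their Gram matrices\<close>

lemma isotropic_frame_det:
  assumes "isotropic_frame q p W W'"
  shows "det (mat_subst (Q_mat q) W) = det (Q_mat q)"
proof -
  have "det W * det W' = 1"
    using assms by (metis isotropic_frame_def det_mul det_I)
  then show ?thesis
    by (auto simp: mat_subst_def det_mul det_transpose zmult_eq_1_iff)
qed

text \<open>Otherwise the first column of the Gram matrix vanishes modulo p, although its
  determinant is \<open>det Q\<close>.\<close>

lemma isotropic_frame_unit:
  assumes "isotropic_frame q p W W'" "\<not> p dvd det (Q_mat q)"
  shows "\<not> p dvd mat_subst (Q_mat q) W $ 3 $ 1"
proof
  let ?F = "mat_subst (Q_mat q) W"
  assume t: "p dvd ?F $ 3 $ 1"
  have "p dvd ?F $ 1 $ 1" "p dvd ?F $ 1 $ 2"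
    using assms by (auto simp: isotropic_frame_def power2_eq_square dest: dvd_mult_left)
  moreover have "?F $ 2 $ 1 = ?F $ 1 $ 2" "?F $ 3 $ 1 = ?F $ 1 $ 3"
    by (rule mat_subst_Q_mat_commute)+
  ultimately have "p dvd det ?F"
    using t by (auto simp: det_3)
  then show False using assms isotropic_frame_det by metis
qed

text \<open>\<open>Q W\<close> is the transpose of \<open>W'\<close> times the Gram matrix, whose
  first column is supported modulo p on its third entry. This ties the isotropic line to the row of
  \<open>W'\<close> seen in \<open>Psi\<close>.\<close>

lemma isotropic_frame_column:
  assumes "isotropic_frame q p W W'"
  shows "[(Q_mat q *v column 1 W) $ i = (mat_subst (Q_mat q) W $ 3 $ 1 *s W' $ 3) $ i] (mod p)"
proof -
  let ?F = "mat_subst (Q_mat q) W"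
  have W: "W ** W' = mat 1" and F1: "p dvd ?F $ 1 $ 1" and F2: "p dvd ?F $ 1 $ 2"
    using assms by (auto simp: isotropic_frame_def power2_eq_square dest: dvd_mult_left)
  have "?F $ 2 $ 1 = ?F $ 1 $ 2"
    by (rule mat_subst_Q_mat_commute)
  with F2 have F2: "p dvd ?F $ 2 $ 1" by simp
  have "transpose W' ** transpose W = mat 1"
    using W by (metis matrix_transpose_mul transpose_mat)
  then have "Q_mat q ** W = transpose W' ** ?F"
    by (simp add: mat_subst_def matrix_mul_assoc)
  then have "(Q_mat q ** W) $ i $ 1 = (transpose W' ** ?F) $ i $ 1" by simp
  then have "(Q_mat q *v column 1 W) $ i = W' $ 1 $ i * ?F $ 1 $ 1 + W' $ 2 $ i * ?F $ 2 $ 1 + W' $ 3 $ i * ?F $ 3 $ 1"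
    by (simp add: matrix_matrix_mult_def matrix_vector_mult_def column_def sum_3 transpose_def)
  then show ?thesis using F1 F2 by (auto simp: cong_iff_dvd_diff algebra_simps)
qed

text \<open>Passes between orthogonality for \<open>q\<close> and for the adjugate form, which the
  norm form controls.\<close>

lemma isotropic_frame_pairing:
  assumes "isotropic_frame q p W W'" "isotropic_frame q p Y Y'"
  shows "[det (Q_mat q) * bilin (Q_mat q) (column 1 W) (column 1 Y) =
      mat_subst (Q_mat q) W $ 3 $ 1 * mat_subst (Q_mat q) Y $ 3 $ 1
        * bilin (adjugate (Q_mat q)) (W' $ 3) (Y' $ 3)] (mod p)"
  unfolding bilin_adjugate_Q_mat[symmetric] bilin_scale[symmetric]
  by (intro bilin_cong isotropic_frame_column assms)

text \<open>A nondegenerate ternary form modulo p has no totally isotropic plane, so orthogonal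
  isotropic vectors are proportional. The pairing of the first columns is entry (1,1) of
  \<open>F ** H\<close>.\<close>

lemma isotropic_frame_unique:
  assumes p: "prime p" and dQ: "\<not> p dvd det (Q_mat q)"
    and W: "isotropic_frame q p W W'" and Y: "isotropic_frame q p Y Y'"
    and WY: "p dvd bilin (Q_mat q) (column 1 W) (column 1 Y)"
  defines "D \<equiv> diag_mat (vector [1, p, p\<^sup>2] :: int ^ 3)"
  shows "\<exists>G. invertible G \<and> Y ** D = W ** D ** G"
proof -
  define F where "F = mat_subst (Q_mat q) W"
  define H where "H = W' ** Y"
  have p0: "p \<noteq> 0" using p by auto
  have p2: "\<not> p dvd 2" using dQ even_det_Q_mat dvd_trans by blast
  have Ws: "W ** W' = mat 1" "W' ** W = mat 1" and Ys: "Y ** Y' = mat 1" "Y' ** Y = mat 1"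
    using W Y by (auto simp: isotropic_frame_def)
  have WH: "W ** H = Y" by (simp add: H_def matrix_mul_assoc Ws)
  have "(W' ** Y) ** (Y' ** W) = W' ** (Y ** Y') ** W" by (simp only: matrix_mul_assoc)
  also have "\<dots> = mat 1" using Ys Ws by simp
  finally have dH: "det H dvd 1" unfolding H_def by (metis det_mul det_I dvd_triv_left)
  have FH: "mat_subst F H = mat_subst (Q_mat q) Y"
    by (simp add: F_def WH[symmetric] mat_subst_mult)
  have "(F ** H) $ 1 $ 1 = (transpose W ** Q_mat q ** Y) $ 1 $ 1"
    by (simp add: F_def mat_subst_def WH[symmetric] matrix_mul_assoc)
  also have "\<dots> = bilin (Q_mat q) (column 1 W) (column 1 Y)"
    by (simp add: column_eq_mult bilin_mult_left bilin_mult_right bilin_axis matrix_mul_assoc)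
  finally have FH1: "p dvd (F ** H) $ 1 $ 1" using WY by simp
  have "\<not> p dvd det F" using isotropic_frame_det[OF W] dQ by (simp add: F_def)
  moreover have "\<not> p dvd det H" using dH p by (meson dvd_trans not_prime_unit)
  moreover have "transpose F = F" by (simp add: F_def transpose_mat_subst)
  ultimately have "p dvd H $ 2 $ 1" "p\<^sup>2 dvd H $ 3 $ 1" "p dvd H $ 3 $ 2"
    using isotropic_base_change[OF p p2, of F H] W Y FH FH1
    by (auto simp: isotropic_frame_def F_def)
  then obtain a b c where abc: "H $ 2 $ 1 = p * a" "H $ 3 $ 1 = p\<^sup>2 * b" "H $ 3 $ 2 = p * c"
    by (auto elim!: dvdE)
  \<comment> \<open>\<open>G\<close> is \<open>D^-1 H D\<close>; the divisibilities make its entries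
    below the diagonal integral.\<close>
  define G :: "int ^ 3 ^ 3" where "G = vector [vector [H $ 1 $ 1, p * H $ 1 $ 2, p\<^sup>2 * H $ 1 $ 3],
    vector [a, H $ 2 $ 2, p * H $ 2 $ 3], vector [b, c, H $ 3 $ 3]]"
  have DG: "D ** G = H ** D"
    unfolding D_def vec_eq_iff matrix_mult_diag_mat_nth diag_mat_mult_matrix_nth
    by (simp add: forall_3 G_def abc power2_eq_square)
  have "det D \<noteq> 0" using p0 by (simp add: D_def diag_mat_def det_3)
  moreover have "det D * det G = det H * det D" using DG by (metis det_mul)
  ultimately have "det G = det H" by simp
  then have "invertible G" using dH invertible_if_det_dvd_1 by metis
  moreover have "Y ** D = W ** D ** G"
    by (simp add: WH[symmetric] DG flip: matrix_mul_assoc)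
  ultimately show ?thesis by blast
qed

lemma isotropic_frame_of_GL_double_coset:
  assumes p: "p \<noteq> 0" and A: "A \<in> GL_double_coset (diag_mat (vector [1, p, p\<^sup>2] :: int ^ 3))"
    and QA: "mat_cong (mat_subst (Q_mat q) A) 0 (p\<^sup>2)"
  obtains W W' V V' where "isotropic_frame q p W W'" "V ** V' = mat 1" "V' ** V = mat 1"
    "A = W ** diag_mat (vector [1, p, p\<^sup>2]) ** V"
proof -
  let ?D = "diag_mat (vector [1, p, p\<^sup>2] :: int ^ 3)"
  obtain W W' V V' where W: "W ** W' = mat 1" "W' ** W = mat 1"
    and V: "V ** V' = mat 1" "V' ** V = mat 1" and A: "A = W ** ?D ** V"
    using A unfolding GL_double_coset_def invertible_def by auto
  have "W ** ?D = A ** V'" using V by (simp add: A flip: matrix_mul_assoc)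
  then have "mat_cong (mat_subst (Q_mat q) (W ** ?D)) 0 (p\<^sup>2)"
    using QA by (simp add: mat_subst_mult mat_cong_0_subst)
  then have "p\<^sup>2 dvd mat_subst (Q_mat q) (W ** ?D) $ 1 $ 1"
    and "p\<^sup>2 dvd mat_subst (Q_mat q) (W ** ?D) $ 1 $ 2"
    by (simp_all add: mat_cong_0_iff)
  \<comment> \<open>The diagonal factors at (1,1) and (1,2) are 1 and p, which leaves the frame
    conditions.\<close>
  then have "isotropic_frame q p W W'"
    using p W by (simp add: isotropic_frame_def mat_subst_diag_mat_nth power2_eq_square)
  then show thesis using V A that by blast
qed

text \<open>Outside (1,1), (1,2), (2,1) the diagonal factors already contain p^2.\<close>

lemma mat_cong_isotropic_frame:
  assumes "isotropic_frame q p W W'"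
  shows "mat_cong (mat_subst (Q_mat q) (W ** diag_mat (vector [1, p, p\<^sup>2]))) 0 (p\<^sup>2)"
  using assms mat_subst_Q_mat_commute[of q W 2 1]
  by (auto simp: isotropic_frame_def mat_cong_0_iff mat_subst_diag_mat_nth forall_3 power2_eq_square)

text \<open>The adjugate turns \<open>y\<close> into a vector isotropic modulo p. A Hensel step
  lifts it modulo p^2, a multiple of it is completed to a unimodular matrix, and changing the other
  columns clears entry (1,2) of the Gram matrix modulo p.\<close>

lemma exists_isotropic_frame:
  assumes p: "prime p" and dQ: "\<not> p dvd det (Q_mat q)"
    and iso: "p dvd bilin (adjugate (Q_mat q)) y y" and y: "\<not> p dvd y $ i"
  obtains W c where "isotropic_frame q p W (adjugate W)" "det W = 1"
    "\<And>j. [(Q_mat q *v column 1 W) $ j = c * y $ j] (mod p)"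
proof -
  let ?Q = "Q_mat q"
  have p2: "\<not> p dvd 2" using dQ even_det_Q_mat dvd_trans by blast
  define v0 where "v0 = adjugate ?Q *v y"
  have Qv0: "(?Q *v v0) $ j = det ?Q * y $ j" for j
    by (simp add: v0_def matrix_vector_mul_assoc mult_adjugate_3 mat_mult_vector_nth)
  have "bilin ?Q v0 v0 = bilin (mat 1) v0 (?Q *v v0)"
    by (simp add: bilin_mult_right)
  also have "\<dots> = det ?Q * bilin (mat 1) v0 y"
    by (simp add: bilin_def Qv0 sum_3 mat_def algebra_simps)
  also have "bilin (mat 1) v0 y = bilin (adjugate ?Q) y y"
    by (simp add: bilin_def v0_def sum_3 mat_def matrix_vector_mult_def algebra_simps)
  finally obtain f where f: "bilin ?Q v0 v0 = p * f" using iso by (metis dvdE dvd_mult)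
  have u: "\<not> p dvd (?Q *v v0) $ i" using p dQ y by (simp add: Qv0 prime_dvd_mult_iff)
  \<comment> \<open>This is the derivative of \<open>bilin ?Q v v\<close> at \<open>v0\<close> in
    direction \<open>i\<close>, a unit as p is odd, so the Hensel correction exists.\<close>
  then have "\<not> p dvd 2 * (?Q *v v0) $ i" using p p2 by (metis prime_dvd_mult_iff)
  then obtain k where k: "p dvd f + 2 * (?Q *v v0) $ i * k"
    using ex_root_mod_prime p by blast
  txt \<open>Lift \<open>v0\<close> to an isotropic vector modulo \<open>p\<^sup>2\<close>.\<close>
  define v where "v = v0 + (p * k) *s axis i 1"
  have Qv: "(?Q *v v) $ j = (?Q *v v0) $ j + p * k * ?Q $ j $ i" for j
    by (simp add: v_def matrix_vector_mult_def axis_def distrib_left sum.distrib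
        if_distrib[of "(*) _"] mult.commute cong: if_cong)
  have "bilin ?Q v v = bilin ?Q v0 v0 + 2 * (p * k) * (?Q *v v0) $ i + p * k * (p * k) * ?Q $ i $ i"
  proof -
    have "i = 1 \<or> i = 2 \<or> i = 3" by (rule exhaust_3)
    then show ?thesis
      by (auto simp: v_def bilin_def matrix_vector_mult_def sum_3 axis_def algebra_simps)
  qed
  also have "\<dots> = p * (f + 2 * (?Q *v v0) $ i * k) + p\<^sup>2 * (k * k * ?Q $ i $ i)"
    by (simp add: f algebra_simps power2_eq_square)
  finally have vv: "p\<^sup>2 dvd bilin ?Q v v" using k by (simp add: power2_eq_square mult_dvd_mono)
  have "\<exists>l. \<not> p dvd v $ l"
  proof (rule ccontr)
    assume "\<nexists>l. \<not> p dvd v $ l"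
    then have "p dvd (?Q *v v) $ i"
      unfolding matrix_vector_mult_def by (auto intro!: dvd_sum)
    then show False using u Qv by (simp add: dvd_add_left_iff)
  qed
  then obtain l where "\<not> p dvd v $ l" ..
  then obtain W1 c where W1: "det W1 = 1" and c: "\<And>j. p\<^sup>2 dvd W1 $ j $ 1 - c * v $ j"
    using exists_unimodular_column[OF p] by blast
  have c: "[column 1 W1 $ j = (c *s v) $ j] (mod p\<^sup>2)" for j
    using c by (simp add: column_def cong_iff_dvd_diff)
  let ?G = "mat_subst ?Q W1"
  have "[?G $ 1 $ 1 = c * c * bilin ?Q v v] (mod p\<^sup>2)"
    unfolding mat_subst_nth bilin_scale[symmetric] by (intro bilin_cong c)
  then have G11: "p\<^sup>2 dvd ?G $ 1 $ 1" using vv by (metis cong_dvd_iff dvd_mult)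
  \<comment> \<open>\<open>E\<close> fixes the first column and has determinant 1. It either moves
    the third column into second place or adds \<open>k\<close> times it to the second; only in the
    latter case is \<open>k\<close> guaranteed to solve the congruence.\<close>
  define k where "k = (SOME k. p dvd ?G $ 1 $ 2 + ?G $ 1 $ 3 * k)"
  define E :: "int ^ 3 ^ 3" where "E = (if p dvd ?G $ 1 $ 3
    then vector [vector [1, 0, 0], vector [0, 0, -1], vector [0, 1, 0]]
    else vector [vector [1, 0, 0], vector [0, 1, 0], vector [0, k, 1]])"
  define W where "W = W1 ** E"
  have dW: "det W = 1" by (simp add: W_def det_mul W1) (simp add: E_def det_3)
  have W1c: "column 1 W = column 1 W1"
    by (simp add: W_def E_def vec_eq_iff column_def matrix_matrix_mult_def sum_3)
  have WE: "mat_subst ?Q W = mat_subst ?G E" unfolding W_def by (rule mat_subst_mult)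
  have W12: "p dvd mat_subst ?Q W $ 1 $ 2"
  proof (cases "p dvd ?G $ 1 $ 3")
    case True
    then show ?thesis
      by (simp add: WE E_def mat_subst_nth[of ?G] bilin_def column_def sum_3)
  next
    case False
    then have "\<exists>k. p dvd ?G $ 1 $ 2 + ?G $ 1 $ 3 * k" using ex_root_mod_prime p by blast
    then have "p dvd ?G $ 1 $ 2 + ?G $ 1 $ 3 * k" unfolding k_def by (rule someI_ex)
    with False show ?thesis
      by (simp add: WE E_def mat_subst_nth[of ?G] bilin_def column_def sum_3)
  qed
  have "isotropic_frame q p W (adjugate W)"
    using W12 G11 by (simp add: isotropic_frame_def mult_adjugate_3 adjugate_mult_3 dW
      mat_subst_nth W1c)
  moreover have "[(?Q *v column 1 W) $ j = c * det ?Q * y $ j] (mod p)" for j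
  proof -
    have "p dvd p\<^sup>2" by (simp add: power2_eq_square)
    then have "[column 1 W1 $ l = (c *s v) $ l] (mod p)" for l
      using c cong_dvd_modulus by blast
    then have "[(?Q *v column 1 W) $ j = (?Q *v (c *s v)) $ j] (mod p)"
      unfolding W1c matrix_vector_mult_def by (auto intro!: cong_sum cong_mult)
    also have "(?Q *v (c *s v)) $ j = c * (?Q *v v) $ j"
      by (simp add: matrix_vector_mult_scale)
    also have "[c * (?Q *v v) $ j = c * det ?Q * y $ j] (mod p)"
      by (simp add: Qv Qv0 cong_iff_dvd_diff algebra_simps)
    finally show ?thesis .
  qed
  ultimately show thesis using that dW by blast
qed

section \<open>The matrix \<open>\<Psi>\<^sub>A\<close>\<close>

text \<open>Only the lower right block of \<open>\<Psi>\<^sub>A\<close> and the integrality of its first row matter here, so the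
  sign of \<open>det A\<close> plays no role.\<close>

lemma Psi_eq_imp_im_part:
  fixes W W' V V' :: "int ^ 3 ^ 3"
  assumes p: "p \<noteq> 0" and W: "W ** W' = mat 1" and V: "V ** V' = mat 1"
    and S: "Psi q p (W ** diag_mat (vector [1, p, p\<^sup>2]) ** V) = map_matrix of_int S"
  shows "im_part (S *v vector [0, V $ 3 $ 1, V $ 3 $ 2, V $ 3 $ 3]) = W' $ 3"
proof -
  let ?D = "diag_mat (vector [1, p, p\<^sup>2] :: int ^ 3)" and ?E = "diag_mat (vector [p\<^sup>2, p, 1] :: int ^ 3)"
  let ?A = "W ** ?D ** V"
  define T where "T = V' ** ?E ** W'"
  have "?A ** T = mat (p\<^sup>2)"
    unfolding T_def by (rule scaled_inverse_mult[OF W V diag_mat_3_scaled_inverse])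
  then have "map_matrix ((*) (of_int (p\<^sup>2))) (transpose (matrix_inv (map_matrix of_int ?A))) =
      map_matrix (of_int :: int \<Rightarrow> rat) (transpose T)"
    using p by (intro scaled_inverse_transpose) auto
  then have P: "Psi q p ?A = block_1_3 (of_int p) (vector
       [of_int (bilin (Q0_mat q) (column 3 ?A) (column 2 ?A)) / of_int p,
        - of_int (bilin (Q0_mat q) (column 3 ?A) (column 1 ?A)) / of_int p,
        of_int (bilin (Q0_mat q) (column 2 ?A) (column 1 ?A)) / of_int p]) 0
        (map_matrix of_int (transpose T))"
    unfolding Psi_def by simp
  have e: "of_int (S $ i $ j) = Psi q p ?A $ i $ j" for i j by (simp add: S)
  have "(of_int (S $ 2 $ 2) :: rat) = of_int (T $ 1 $ 1)" "(of_int (S $ 2 $ 3) :: rat) = of_int (T $ 2 $ 1)"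
     "(of_int (S $ 2 $ 4) :: rat) = of_int (T $ 3 $ 1)" "(of_int (S $ 3 $ 2) :: rat) = of_int (T $ 1 $ 2)"
     "(of_int (S $ 3 $ 3) :: rat) = of_int (T $ 2 $ 2)" "(of_int (S $ 3 $ 4) :: rat) = of_int (T $ 3 $ 2)"
     "(of_int (S $ 4 $ 2) :: rat) = of_int (T $ 1 $ 3)" "(of_int (S $ 4 $ 3) :: rat) = of_int (T $ 2 $ 3)"
     "(of_int (S $ 4 $ 4) :: rat) = of_int (T $ 3 $ 3)"
    unfolding e P by (simp_all add: block_1_3_nth vector_4_nth transpose_def)
  \<comment> \<open>Since \<open>V ** T = ?E ** W'\<close> and the last diagonal entry of
    \<open>?E\<close> is 1, testing with the third row of \<open>V\<close> isolates that of
    \<open>W'\<close>.\<close>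
  then have "im_part (S *v vector [0, V $ 3 $ 1, V $ 3 $ 2, V $ 3 $ 3]) = (V ** T) $ 3"
    by (simp add: vec_eq_iff forall_3 matrix_vector_mult_def matrix_matrix_mult_def sum_4 sum_3
        vector_4_nth mult.commute)
  also have "V ** T = (V ** V') ** ?E ** W'" by (simp only: T_def matrix_mul_assoc)
  then have "(V ** T) $ 3 = W' $ 3"
    by (simp add: V vec_eq_iff diag_mat_mult_matrix_nth)
  finally show ?thesis .
qed

text \<open>The column scalings 1, p, p^2 absorb the denominators p. Only the last column can be
  nonzero modulo p.\<close>

lemma Psi_of_frame:
  assumes p: "p \<noteq> 0" and W: "det W = 1"
  shows "Psi q p (W ** diag_mat (vector [1, p, p\<^sup>2])) = map_matrix of_int
    (block_1_3 p
      (vector [p * p * bilin (Q0_mat q) (column 3 W) (column 2 W),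
               - p * bilin (Q0_mat q) (column 3 W) (column 1 W),
               bilin (Q0_mat q) (column 2 W) (column 1 W)]) 0
      (transpose (diag_mat (vector [p\<^sup>2, p, 1]) ** adjugate W)))"
    (is "Psi q p ?A = map_matrix of_int (block_1_3 p ?r 0 (transpose ?T))")
proof -
  have "(W ** diag_mat (vector [1, p, p\<^sup>2]) ** mat 1) ** (mat 1 ** diag_mat (vector [p\<^sup>2, p, 1]) ** adjugate W)
      = mat (p\<^sup>2)"
    by (rule scaled_inverse_mult[OF _ _ diag_mat_3_scaled_inverse])
      (simp_all add: mult_adjugate_3 W)
  then have "?A ** ?T = mat (p\<^sup>2)" by simp
  then have T: "map_matrix ((*) (of_int (p\<^sup>2))) (transpose (matrix_inv (map_matrix of_int ?A))) =
      map_matrix (of_int :: int \<Rightarrow> rat) (transpose ?T)"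
    using p by (intro scaled_inverse_transpose) auto
  have c: "column j ?A = vector [1, p, p\<^sup>2] $ j *s column j W" for j
    by (simp add: vec_eq_iff column_def matrix_mult_diag_mat_nth)
  have s: "bilin P (a *s x) y = a * bilin P x y" "bilin P x (a *s y) = a * bilin P x y"
    for P :: "int ^ 3 ^ 3" and a x y
    using bilin_scale[of P a x 1 y] bilin_scale[of P 1 x a y] by simp_all
  show ?thesis
    unfolding Psi_def T c s using p
    by (simp add: vec_eq_iff forall_4 block_1_3_nth vector_4_nth power2_eq_square)
qed

text \<open>\<open>Q\<close> is \<open>Q_0\<close> plus its transpose, and the skew part of
  \<open>Q_0\<close> pairs \<open>B\<close> with the cross product of the first two columns, the
  third row of the adjugate. Thus for a frame with \<open>det W = 1\<close> the last column of
  \<open>Psi\<close> has trace 0 modulo p.\<close>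

lemma frame_Psi_trace:
  "2 * bilin (Q0_mat q) (column 2 W) (column 1 W) =
    mat_subst (Q_mat q) W $ 2 $ 1 + (B_vec q $ 1 * adjugate W $ 3 $ 1
      + B_vec q $ 2 * adjugate W $ 3 $ 2 + B_vec q $ 3 * adjugate W $ 3 $ 3)"
  by (simp add: mat_subst_nth bilin_def sum_3 Q0_mat_def B_vec_def adjugate_def det_3 axis_def
      column_def algebra_simps)

section \<open>The lattice spanned by the columns of \<open>M\<close>\<close>

text \<open>\<open>?D\<close> fixes the span of the first two basis vectors. One linear form on this
  plane has a nonzero zero modulo p, and the invertible \<open>U\<close> keeps it nonzero.\<close>

lemma exists_traceless_lattice_vector:
  assumes p: "prime p" and M: "M \<in> GL_double_coset (diag_mat (vector [1, 1, p, p]))"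
  obtains z i where "p dvd clifford_trace q (M *v z)" "\<not> p dvd (M *v z) $ i"
proof -
  let ?D = "diag_mat (vector [1, 1, p, p] :: int ^ 4)"
  obtain U U' V V' where U: "U' ** U = mat 1" and V: "V ** V' = mat 1" and MD: "M = U ** ?D ** V"
    using M unfolding GL_double_coset_def invertible_def mem_Collect_eq by blast
  define e where "e a b = (vector [a, b, 0, 0] :: int ^ 4)" for a b
  define t where "t a b = clifford_trace q (U *v e a b)" for a b
  have lin: "t a b = a * t 1 0 + b * t 0 1" for a b
    by (simp add: t_def e_def clifford_trace_def matrix_vector_mult_def sum_4 vector_4_nth algebra_simps)
  obtain a b where ab: "p dvd t a b" "\<not> (p dvd a \<and> p dvd b)"
  proof (cases "p dvd t 1 0 \<and> p dvd t 0 1")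
    case True
    then show thesis using that[of 1 0] p not_prime_unit by blast
  next
    case False
    then show thesis using that[of "t 0 1" "- t 1 0"] by (auto simp: lin[of "t 0 1"])
  qed
  have "?D *v e a b = e a b"
    by (simp add: e_def vec_eq_iff forall_4 matrix_vector_mult_def diag_mat_def sum_4 vector_4_nth)
  moreover have "M *v (V' *v e a b) = U *v (?D *v ((V ** V') *v e a b))"
    by (simp only: MD matrix_vector_mul_assoc matrix_mul_assoc)
  ultimately have Me: "M *v (V' *v e a b) = U *v e a b" by (simp add: V)
  have "\<exists>i. \<not> p dvd (U *v e a b) $ i"
  proof (rule ccontr)
    assume "\<nexists>i. \<not> p dvd (U *v e a b) $ i"
    then have "p dvd (U' *v (U *v e a b)) $ i" for i
      unfolding matrix_vector_mult_def[of U'] by (auto intro!: dvd_sum)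
    then have "p dvd e a b $ i" for i by (simp add: matrix_vector_mul_assoc U)
    then have "p dvd e a b $ 1" "p dvd e a b $ 2" by blast+
    with ab show False by (simp add: e_def vector_4_nth)
  qed
  then show thesis using that Me ab(1) by (metis t_def)
qed

text \<open>\<open>M\<close> divides the scalar matrix p, so membership in its column lattice is
  decided modulo p.\<close>

lemma lattice_closed_under_cong:
  fixes M :: "int ^ 4 ^ 4"
  assumes M: "M \<in> GL_double_coset (diag_mat (vector [1, 1, p, p]))"
    and x: "\<And>i. [x $ i = c * (M *v z) $ i] (mod p)"
  shows "\<exists>z'. x = M *v z'"
proof -
  let ?D = "diag_mat (vector [1, 1, p, p] :: int ^ 4)" and ?E = "diag_mat (vector [p, p, 1, 1] :: int ^ 4)"
  obtain U U' V V' where U: "U ** U' = mat 1" and V: "V ** V' = mat 1" and MD: "M = U ** ?D ** V"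
    using M unfolding GL_double_coset_def invertible_def mem_Collect_eq by blast
  have T: "M ** (V' ** ?E ** U') = mat p"
    unfolding MD by (rule scaled_inverse_mult[OF U V diag_mat_4_scaled_inverse])
  define w where "w = (\<chi> i. (x $ i - c * (M *v z) $ i) div p)"
  have "x = c *s (M *v z) + mat p *v w"
    using x by (simp add: w_def vec_eq_iff mat_mult_vector_nth cong_iff_dvd_diff)
  also have "\<dots> = M *v (c *s z + (V' ** ?E ** U') *v w)"
    by (simp add: T matrix_vector_mult_scale matrix_vector_right_distrib matrix_vector_mul_assoc)
  finally show ?thesis ..
qed

section \<open>Isotropy of the lattice for the norm form\<close>

lemma bilin_N_mat_lattice:
  assumes "mat_cong (mat_subst (N_mat q) M) 0 p"
  shows "p dvd bilin (N_mat q) (M *v z) (M *v z')"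
proof -
  have "bilin (N_mat q) (M *v z) (M *v z') = bilin (mat_subst (N_mat q) M) z z'"
    by (simp add: bilin_mult_left bilin_mult_right mat_subst_def matrix_mul_assoc)
  then show ?thesis using assms
    by (auto simp: bilin_def mat_cong_0_iff intro!: dvd_sum)
qed

text \<open>Each third row is isotropic modulo p for the adjugate form, so
  \<open>N_mat_bilin\<close> forces the trace of the lattice vector above it to vanish modulo p. The
  same identity for two vectors then makes the rows orthogonal.\<close>

lemma isotropic_frames_orthogonal:
  assumes p: "prime p" and dQ: "\<not> p dvd det (Q_mat q)"
    and W: "isotropic_frame q p W W'" and Y: "isotropic_frame q p Y Y'"
    and N: "mat_cong (mat_subst (N_mat q) M) 0 p"
    and z: "im_part (M *v z) = W' $ 3" and z': "im_part (M *v z') = Y' $ 3"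
  shows "p dvd bilin (Q_mat q) (column 1 W) (column 1 Y)"
proof -
  let ?P = "adjugate (Q_mat q)"
  have iso: "p dvd bilin ?P (X' $ 3) (X' $ 3)" if X: "isotropic_frame q p X X'" for X X'
  proof -
    let ?t = "mat_subst (Q_mat q) X $ 3 $ 1"
    have "p dvd bilin (Q_mat q) (column 1 X) (column 1 X)"
      using X by (auto simp: isotropic_frame_def mat_subst_nth power2_eq_square dest: dvd_mult_left)
    then have "p dvd ?t * ?t * bilin ?P (X' $ 3) (X' $ 3)"
      using isotropic_frame_pairing[OF X X] by (metis cong_dvd_iff dvd_mult)
    then show ?thesis using isotropic_frame_unit[OF X dQ] p by (simp add: prime_dvd_mult_iff)
  qed
  have tr: "p dvd clifford_trace q (M *v z)" if X: "isotropic_frame q p X X'" and "im_part (M *v z) = X' $ 3" for X X' z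
  proof -
    have "p dvd 2 * bilin (N_mat q) (M *v z) (M *v z)" using bilin_N_mat_lattice[OF N] by simp
    then have "p dvd clifford_trace q (M *v z) * clifford_trace q (M *v z)"
      using iso[OF X] that(2) by (simp add: N_mat_bilin dvd_add_left_iff)
    then show ?thesis using p by (simp add: prime_dvd_mult_iff)
  qed
  have "p dvd 2 * bilin (N_mat q) (M *v z) (M *v z')" using bilin_N_mat_lattice[OF N] by simp
  then have "p dvd bilin ?P (W' $ 3) (Y' $ 3)"
    using tr[OF W z] by (simp add: N_mat_bilin z z' dvd_add_right_iff)
  then have "p dvd det (Q_mat q) * bilin (Q_mat q) (column 1 W) (column 1 Y)"
    using isotropic_frame_pairing[OF W Y] by (metis cong_dvd_iff dvd_mult)
  then show ?thesis using p dQ by (simp add: prime_dvd_mult_iff)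
qed

text \<open>A trace-zero lattice vector \<open>u\<close> gives an isotropic line and a frame. Modulo
  p, the last column of its \<open>Psi\<close> is proportional to \<open>u\<close> and the others
  vanish, so all lie in the lattice.\<close>

lemma exists_frame_left_divides:
  assumes p: "prime p" and dQ: "\<not> p dvd det (Q_mat q)"
    and M: "M \<in> GL_double_coset (diag_mat (vector [1, 1, p, p]))"
    and N: "mat_cong (mat_subst (N_mat q) M) 0 p"
  obtains W where "isotropic_frame q p W (adjugate W)"
    "left_divides M (Psi q p (W ** diag_mat (vector [1, p, p\<^sup>2])))"
proof -
  have p2: "\<not> p dvd 2" using dQ even_det_Q_mat dvd_trans by blast
  have p0: "p \<noteq> 0" using p by auto
  have odd: "p dvd x" if "p dvd 2 * x" for x using that p p2 by (metis prime_dvd_mult_iff)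
  obtain z i where tr: "p dvd clifford_trace q (M *v z)" and i: "\<not> p dvd (M *v z) $ i"
    using exists_traceless_lattice_vector[OF p M] .
  define u where "u = M *v z"
  define y where "y = im_part u"
  note tr = tr[folded u_def] and i = i[folded u_def]
  have "p dvd 2 * bilin (N_mat q) u u" using bilin_N_mat_lattice[OF N] by (simp add: u_def)
  then have yy: "p dvd bilin (adjugate (Q_mat q)) y y"
    using tr by (simp add: N_mat_bilin y_def dvd_add_right_iff)
  \<comment> \<open>If trace and imaginary part vanish modulo p, so does the first coordinate, since
    p is odd.\<close>
  have "\<exists>l. \<not> p dvd y $ l"
  proof (rule ccontr)
    assume "\<nexists>l. \<not> p dvd y $ l"
    then have "p dvd y $ 1" "p dvd y $ 2" "p dvd y $ 3" by blast+
    then have u: "p dvd u $ 2" "p dvd u $ 3" "p dvd u $ 4" by (simp_all add: y_def)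
    then have "p dvd 2 * u $ 1" using tr by (simp add: clifford_trace_def dvd_diff_left_iff)
    then have "p dvd u $ 1" by (rule odd)
    with u i show False by (metis exhaust_4)
  qed
  then obtain l where "\<not> p dvd y $ l" ..
  then obtain W c where W: "isotropic_frame q p W (adjugate W)" and dW: "det W = 1"
    and c: "\<And>j. [(Q_mat q *v column 1 W) $ j = c * y $ j] (mod p)"
    using exists_isotropic_frame[OF p dQ yy] by blast
  let ?w = "adjugate W $ 3" and ?t = "mat_subst (Q_mat q) W $ 3 $ 1"
  obtain k where "p dvd - 1 + ?t * k"
    using ex_root_mod_prime[OF p isotropic_frame_unit[OF W dQ]] by blast
  then have k: "[?t * k = 1] (mod p)" by (simp add: cong_iff_dvd_diff)
  have w: "[?w $ j = k * c * y $ j] (mod p)" for j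
  proof -
    have "[1 * ?w $ j = (?t * k) * ?w $ j] (mod p)"
      using k by (intro cong_mult) (auto intro: cong_sym)
    also have "(?t * k) * ?w $ j = k * (?t *s ?w) $ j" by simp
    also have "[k * (?t *s ?w) $ j = k * (Q_mat q *v column 1 W) $ j] (mod p)"
      by (intro cong_mult cong_refl cong_sym[OF isotropic_frame_column[OF W]])
    also have "[k * (Q_mat q *v column 1 W) $ j = k * (c * y $ j)] (mod p)" by (intro cong_mult cong_refl c)
    finally show ?thesis by (simp add: mult.assoc)
  qed
  let ?r = "bilin (Q0_mat q) (column 2 W) (column 1 W)"
  let ?B = "B_vec q"
  \<comment> \<open>The last column of \<open>Psi\<close> and \<open>u\<close> both have trace 0
    modulo p, so proportionality of the imaginary parts extends to the first coordinate.\<close>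
  have r: "[?r = k * c * u $ 1] (mod p)"
  proof -
    have "p dvd mat_subst (Q_mat q) W $ 2 $ 1"
      using W mat_subst_Q_mat_commute[of q W 2 1] by (simp add: isotropic_frame_def)
    then have "[2 * ?r = ?B $ 1 * ?w $ 1 + ?B $ 2 * ?w $ 2 + ?B $ 3 * ?w $ 3] (mod p)"
      by (simp add: frame_Psi_trace cong_iff_dvd_diff)
    also have "[?B $ 1 * ?w $ 1 + ?B $ 2 * ?w $ 2 + ?B $ 3 * ?w $ 3 =
        ?B $ 1 * (k * c * y $ 1) + ?B $ 2 * (k * c * y $ 2) + ?B $ 3 * (k * c * y $ 3)] (mod p)"
      by (intro cong_add cong_mult w cong_refl)
    also have "?B $ 1 * (k * c * y $ 1) + ?B $ 2 * (k * c * y $ 2) + ?B $ 3 * (k * c * y $ 3) =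
        2 * (k * c * u $ 1) - k * c * clifford_trace q u"
      by (simp add: clifford_trace_def y_def algebra_simps)
    also have "[2 * (k * c * u $ 1) - k * c * clifford_trace q u = 2 * (k * c * u $ 1) - 0] (mod p)"
      using tr by (intro cong_diff cong_refl) (simp add: cong_0_iff)
    finally have "p dvd 2 * (?r - k * c * u $ 1)" by (simp add: cong_iff_dvd_diff algebra_simps)
    then have "p dvd ?r - k * c * u $ 1" by (rule odd)
    then show ?thesis by (simp only: cong_iff_dvd_diff)
  qed
  define S where "S = block_1_3 p
      (vector [p * p * bilin (Q0_mat q) (column 3 W) (column 2 W),
               - p * bilin (Q0_mat q) (column 3 W) (column 1 W), ?r]) 0
      (transpose (diag_mat (vector [p\<^sup>2, p, 1]) ** adjugate W))"
  have S4: "S $ 1 $ 4 = ?r" "S $ 2 $ 4 = ?w $ 1" "S $ 3 $ 4 = ?w $ 2" "S $ 4 $ 4 = ?w $ 3"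
    by (simp_all add: S_def block_1_3_nth vector_4_nth transpose_def diag_mat_mult_matrix_nth)
  have S0: "p dvd S $ i $ j" if "j \<noteq> 4" for i j
    using exhaust_4[of i] exhaust_4[of j] that
    by (auto simp: S_def block_1_3_nth vector_4_nth transpose_def diag_mat_mult_matrix_nth
        power2_eq_square)
  have S4u: "[S $ i $ 4 = k * c * u $ i] (mod p)" for i
  proof -
    have "\<forall>i. [S $ i $ 4 = k * c * u $ i] (mod p)"
      unfolding forall_4 S4 using r w[of 1] w[of 2] w[of 3] unfolding y_def im_part_nth by blast
    then show ?thesis ..
  qed
  have "\<exists>z'. column j S = M *v z'" for j
  proof (rule lattice_closed_under_cong[OF M, where z = z])
    show "[column j S $ i = (if j = 4 then k * c else 0) * (M *v z) $ i] (mod p)" for i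
      using S4u[of i] S0[of j i] by (auto simp: column_def u_def cong_0_iff)
  qed
  then have "left_divides M (Psi q p (W ** diag_mat (vector [1, p, p\<^sup>2])))"
    unfolding Psi_of_frame[OF p0 dW] S_def[symmetric] by (rule left_divides_of_int)
  then show thesis using that W by blast
qed

theorem theorem6p5:
  fixes q :: ternary_form and p :: int and M :: "int ^ 4 ^ 4"
  assumes "det (Q_mat q) \<noteq> 0"
    and "prime p" and "\<not> p dvd det (Q_mat q)"
    and "M \<in> GL_double_coset (diag_mat (vector [1, 1, p, p]))"
    and "mat_cong (mat_subst (N_mat q) M) 0 p"
  shows "\<exists>A \<in> GL_double_coset (diag_mat (vector [1, p, p\<^sup>2] :: int ^ 3)).
           mat_cong (mat_subst (Q_mat q) A) 0 (p\<^sup>2) \<and> left_divides M (Psi q p A) \<and>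
           (\<forall>A' \<in> GL_double_coset (diag_mat (vector [1, p, p\<^sup>2] :: int ^ 3)).
              mat_cong (mat_subst (Q_mat q) A') 0 (p\<^sup>2) \<and> left_divides M (Psi q p A') \<longrightarrow>
              (\<exists>V. invertible V \<and> A' = A ** V))"
proof -
  let ?D = "diag_mat (vector [1, p, p\<^sup>2] :: int ^ 3)"
  have p0: "p \<noteq> 0" using assms(2) by auto
  obtain W where W: "isotropic_frame q p W (adjugate W)"
    and div: "left_divides M (Psi q p (W ** ?D))"
    using exists_frame_left_divides[OF assms(2-5)] .
  \<comment> \<open>Left divisibility puts the image of \<open>Psi\<close> on integral vectors into
    the column lattice of \<open>M\<close>.\<close>
  have lattice: "\<exists>z. im_part (M *v z) = Y' $ 3"
    if Y: "isotropic_frame q p Y Y'" and V: "V ** V' = mat 1"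
      and div: "left_divides M (Psi q p (Y ** ?D ** V))" for Y Y' V V'
  proof -
    obtain X where "Psi q p (Y ** ?D ** V) = map_matrix of_int (M ** X)"
      using div by (rule left_divides_obtains)
    then have "im_part ((M ** X) *v vector [0, V $ 3 $ 1, V $ 3 $ 2, V $ 3 $ 3]) = Y' $ 3"
      using Psi_eq_imp_im_part[OF p0 _ V] Y isotropic_frame_def by blast
    then show ?thesis by (metis matrix_vector_mul_assoc)
  qed
  obtain z where z: "im_part (M *v z) = adjugate W $ 3"
    using lattice[OF W, of "mat 1" "mat 1"] div by auto
  show ?thesis
  proof (intro bexI[of _ "W ** ?D"] conjI ballI impI)
    have "invertible W" using W by (auto simp: isotropic_frame_def invertible_def)
    moreover have "invertible (mat 1 :: int ^ 3 ^ 3)" by (auto simp: invertible_def intro: exI[of _ "mat 1"])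
    ultimately show "W ** ?D \<in> GL_double_coset ?D"
      unfolding GL_double_coset_def mem_Collect_eq by (metis matrix_mul_rid)
    show "mat_cong (mat_subst (Q_mat q) (W ** ?D)) 0 (p\<^sup>2)"
      using W by (rule mat_cong_isotropic_frame)
    show "left_divides M (Psi q p (W ** ?D))" by (rule div)
  next
    fix A'
    assume A': "A' \<in> GL_double_coset ?D"
      and "mat_cong (mat_subst (Q_mat q) A') 0 (p\<^sup>2) \<and> left_divides M (Psi q p A')"
    then have QA': "mat_cong (mat_subst (Q_mat q) A') 0 (p\<^sup>2)" and div': "left_divides M (Psi q p A')"
      by auto
    obtain Y Y' V V' where Y: "isotropic_frame q p Y Y'" and V: "V ** V' = mat 1" "V' ** V = mat 1"
      and A'_eq: "A' = Y ** ?D ** V"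
      using isotropic_frame_of_GL_double_coset[OF p0 A' QA'] .
    obtain z' where "im_part (M *v z') = Y' $ 3"
      using lattice[OF Y V(1)] div' A'_eq by auto
    then have "p dvd bilin (Q_mat q) (column 1 W) (column 1 Y)"
      using isotropic_frames_orthogonal[OF assms(2,3) W Y assms(5) z] by blast
    then obtain G where G: "invertible G" "Y ** ?D = W ** ?D ** G"
      using isotropic_frame_unique[OF assms(2,3) W Y] by blast
    have "invertible V" using V unfolding invertible_def by blast
    with G have "invertible (G ** V)" by (simp add: invertible_mult)
    moreover have "A' = W ** ?D ** (G ** V)" by (simp add: A'_eq G matrix_mul_assoc)
    ultimately show "\<exists>V. invertible V \<and> A' = W ** ?D ** V" by blast
  qed
qed

end
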